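(* There is a four-dimensional variety of basis changes by $\mathrm{SL}(2,\mathbb{C})^4$ such that (after the change of basis) $\mathrm{SWAP}=P+Q$, where $P$ is Pfaffian (i.e. a Pfaffian cogate, $P\in\mathcal{P}_4^\vee$) and $Q\in((\mathbb{C}^2)^* )^{\otimes 4}$ has odd support.
   Context: Notation: $\{v_0,v_1\}$ is an orthonormal basis of $\mathbb{C}^2$ with dual basis $\{v_0^*,v_1^*\}$, and $\langle i_1\cdots i_k|=v_{i_1}^*\otimes\cdots\otimes v_{i_k}^*$. For $I\subseteq[n]=\{1,\dots,n\}$, $\langle I|=\langle\chi_I(1)\cdots\chi_I(n)|$ where $\chi_I$ is the indicator function of $I$, and $\overline I=[n]\setminus I$. The SWAP gate is the covector $\mathrm{SWAP}=\langle 0000|+\langle 0101|+\langle 1010|+\langle 1111|\in((\mathbb{C}^2)^* )^{\otimes4}$. A basis change by $(g_1,g_2,g_3,g_4)\in\mathrm{SL}(2,\mathbb{C})^4$ replaces a covector $\phi\in((\mathbb{C}^2)^* )^{\otimes4}$ by $\phi\circ(g_1\otimes g_2\otimes g_3\otimes g_4)$. For a $4\times4$ skew-symmetric complex matrix $A$ let $A_I$ be the principal submatrix with rows and columns in $I$, and put $\mathrm{sPf}^\vee_4(A)=\sum_{I\subseteq[4]}\mathrm{Pf}(A_I)\,\langle\overline I|$, where $\mathrm{Pf}$ of the empty matrix is $1$ and $\mathrm{Pf}$ of an odd-size matrix is $0$. The variety $\mathcal{P}_4^\vee\subset((\mathbb{C}^2)^* )^{\otimes4}$ of (elementary) arity-4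 Pfaffian cogates is the image of $\mathrm{sPf}_4^\vee$. A covector $\sum_{I\subseteq[n]}\beta_I\langle I|$ has odd support if $\beta_I=0$ whenever $|I|$ is even. *)

theory Defs
  imports "HOL-Analysis.Analysis" "HOL-Combinatorics.Permutations" "HOL-Library.Extended_Nat"
begin

text \<open>
  Conventions. The tensor factors 1, ..., 4 are indexed by the elements \<open>0 < 1 < 2 < 3\<close> of
  the type \<open>4\<close>, whose library order is the order of the factors (note that \<open>4 = 0\<close> in this type).
  The orthonormal basis of \<open>\<complex>\<^sup>2\<close> is the standard one, \<open>v\<^sub>i = axis i 1\<close> for \<open>i \<in> {0, 1}\<close>,
  the elements of the type \<open>2\<close>.  Covectors of arity 4, i.e. elements of the fourth tensor power
  of the dual of \<open>\<complex>\<^sup>2\<close>, are identified with 4-linear forms, evaluated at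
  \<open>x $ 0 \<otimes> x $ 1 \<otimes> x $ 2 \<otimes> x $ 3\<close>.
\<close>

type_synonym covector4 = "complex ^ 2 ^ 4 \<Rightarrow> complex"

definition bra :: "2 \<Rightarrow> 2 \<Rightarrow> 2 \<Rightarrow> 2 \<Rightarrow> covector4" where
  "bra i1 i2 i3 i4 = (\<lambda>x. x $ 0 $ i1 * x $ 1 $ i2 * x $ 2 $ i3 * x $ 3 $ i4)"

definition bra_set :: "4 set \<Rightarrow> covector4" where
  "bra_set I = bra (indicator I 0) (indicator I 1) (indicator I 2) (indicator I 3)"

definition SWAP :: covector4 where
  "SWAP = (\<lambda>x. bra 0 0 0 0 x + bra 0 1 0 1 x + bra 1 0 1 0 x + bra 1 1 1 1 x)"

definition odd_support :: "covector4 \<Rightarrow> bool" where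
  "odd_support \<phi> \<longleftrightarrow>
    (\<exists>\<beta> :: 4 set \<Rightarrow> complex.
      \<phi> = (\<lambda>x. \<Sum>I\<in>UNIV. \<beta> I * bra_set I x) \<and> (\<forall>I. even (card I) \<longrightarrow> \<beta> I = 0))"


subsection \<open>Pfaffian cogates\<close>

text \<open>The Pfaffian of the \<open>n \<times> n\<close> matrix with entries \<open>B i j\<close>, \<open>i, j < n\<close>.\<close>

definition pfaffian :: "nat \<Rightarrow> (nat \<Rightarrow> nat \<Rightarrow> complex) \<Rightarrow> complex" where
  "pfaffian n B =
    (if even n then
       (\<Sum>\<sigma> | \<sigma> permutes {..<n}.
          of_int (sign \<sigma>) * (\<Prod>i<n div 2. B (\<sigma> (2 * i)) (\<sigma> (2 * i + 1))))
       / (2 ^ (n div 2) * fact (n div 2))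
     else 0)"

definition principal_submatrix :: "complex ^ 4 ^ 4 \<Rightarrow> 4 set \<Rightarrow> nat \<Rightarrow> nat \<Rightarrow> complex" where
  "principal_submatrix A I =
    (\<lambda>i j. A $ (sorted_list_of_set I ! i) $ (sorted_list_of_set I ! j))"

definition sPf_dual :: "complex ^ 4 ^ 4 \<Rightarrow> covector4" where
  "sPf_dual A =
    (\<lambda>x. \<Sum>I\<in>UNIV. pfaffian (card I) (principal_submatrix A I) * bra_set (- I) x)"

definition pfaffian_cogates :: "covector4 set" where
  "pfaffian_cogates = sPf_dual ` {A. transpose A = - A}"


subsection \<open>Basis changes\<close>

type_synonym matrices4 = "complex ^ 2 ^ 2 ^ 4"

definition SL2_pow4 :: "matrices4 set" where
  "SL2_pow4 = {g. \<forall>k. det (g $ k) = 1}"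

definition change_basis :: "covector4 \<Rightarrow> matrices4 \<Rightarrow> covector4" where
  "change_basis \<phi> g = (\<lambda>x. \<phi> (\<chi> k. g $ k *v x $ k))"


subsection \<open>Varieties in the affine space of quadruples of matrices\<close>

inductive polynomial_fun :: "(matrices4 \<Rightarrow> complex) \<Rightarrow> bool" where
  const: "polynomial_fun (\<lambda>g. c)"
| coord: "polynomial_fun (\<lambda>g. g $ k $ i $ j)"
| add: "polynomial_fun p \<Longrightarrow> polynomial_fun q \<Longrightarrow> polynomial_fun (\<lambda>g. p g + q g)"
| mult: "polynomial_fun p \<Longrightarrow> polynomial_fun q \<Longrightarrow> polynomial_fun (\<lambda>g. p g * q g)"

definition zariski_closed :: "matrices4 set \<Rightarrow> bool" where
  "zariski_closed V \<longleftrightarrow>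
    (\<exists>F. (\<forall>f\<in>F. polynomial_fun f) \<and> V = {g. \<forall>f\<in>F. f g = 0})"

definition affine_variety :: "matrices4 set \<Rightarrow> bool" where
  "affine_variety V \<longleftrightarrow> zariski_closed V \<and> V \<noteq> {} \<and>
    (\<forall>A B. zariski_closed A \<and> zariski_closed B \<and> V = A \<union> B \<longrightarrow> V = A \<or> V = B)"

text \<open>
  The (Krull) dimension: the supremum of the lengths \<open>n\<close> of chains
  \<open>Z 0 \<subset> Z 1 \<subset> \<dots> \<subset> Z n\<close> of irreducible closed subsets of \<open>V\<close>.
\<close>

definition variety_dim :: "matrices4 set \<Rightarrow> enat" where
  "variety_dim V =
    Sup {enat n | n. \<exists>Z. (\<forall>i\<le>n. affine_variety (Z i) \<and> Z i \<subseteq> V) \<and> (\<forall>i<n. Z i \<subset> Z (Suc i))}"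

end

theory Submission
  imports Defs "HOL-Library.Function_Algebras"
begin

text \<open>
  Put \<open>M = g\<^sub>0\<^sup>T g\<^sub>2\<close> and \<open>N = g\<^sub>1\<^sup>T g\<^sub>3\<close>. After the basis change, the coefficient of SWAP at
  \<open>\<langle>i j k l|\<close> is \<open>M\<^sub>i\<^sub>k N\<^sub>j\<^sub>l\<close>, and its even part is a Pfaffian cogate iff the coefficient at
  \<open>\<langle>1111|\<close> is 1 and the one at \<open>\<langle>0000|\<close> is the Pfaffian of the coefficients of weight 2. This gives
  the equations \<open>M\<^sub>1\<^sub>1 N\<^sub>1\<^sub>1 = 1\<close> and \<open>M\<^sub>0\<^sub>1 M\<^sub>1\<^sub>0 N\<^sub>0\<^sub>1 N\<^sub>1\<^sub>0 = M\<^sub>0\<^sub>0 N\<^sub>0\<^sub>0\<close>. We choose a family of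
  solutions in \<open>SL(2)\<^sup>4\<close> that is a closed polynomial embedding of \<open>\<complex>\<^sup>4\<close>.

  The dimension of an embedded affine space is bounded from above by Hilbert functions: along a
  chain of irreducible closed sets \<open>Z\<^sub>0 \<subset> \<dots> \<subset> Z\<^sub>n\<close> one has
  \<open>h\<^sub>i\<^sub>+\<^sub>1(d + e) \<ge> h\<^sub>i\<^sub>+\<^sub>1(d) + h\<^sub>i(d + e)\<close> for some fixed \<open>e\<close>, so that \<open>h\<^sub>n(e d) \<ge> (d + n choose n)\<close>,
  while \<open>h\<^sub>n(d) \<le> (d + 1)\<^sup>m\<close> inside an embedded \<open>\<complex>\<^sup>m\<close>.
\<close>

subsection \<open>Polynomial functions of bounded degree\<close>

interpretation fun_vs: vector_space "\<lambda>(c::complex) (f::'a \<Rightarrow> complex) x. c * f x"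
  by unfold_locales (auto simp: fun_eq_iff algebra_simps)

definition monomial_fun :: "('n::finite \<Rightarrow> nat) \<Rightarrow> complex ^ 'n \<Rightarrow> complex" where
  "monomial_fun \<alpha> = (\<lambda>y. \<Prod>k\<in>UNIV. y $ k ^ \<alpha> k)"

text \<open>The bound is on each exponent separately, not on the total degree: there are then
  exactly (D + 1)^n monomials, and bounds still add under multiplication.\<close>

definition poly_upto :: "nat \<Rightarrow> (complex ^ 'n \<Rightarrow> complex) set" where
  "poly_upto D = fun_vs.span (monomial_fun ` {\<alpha>. \<forall>k. \<alpha> k \<le> D})"

lemma poly_upto_mono: "D \<le> E \<Longrightarrow> poly_upto D \<subseteq> poly_upto E"
  unfolding poly_upto_def by (intro fun_vs.span_mono) (auto intro: order_trans)

lemma poly_upto_induct [consumes 1, case_names zero add scale monomial]: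
  assumes "f \<in> poly_upto D"
    and zero: "P (\<lambda>y. 0)"
    and add: "\<And>f g. \<lbrakk>P f; P g\<rbrakk> \<Longrightarrow> P (\<lambda>y. f y + g y)"
    and scale: "\<And>c f. P f \<Longrightarrow> P (\<lambda>y. c * f y)"
    and monomial: "\<And>\<alpha>. (\<And>k. \<alpha> k \<le> D) \<Longrightarrow> P (monomial_fun \<alpha>)"
  shows "P f"
proof -
  have "f \<in> fun_vs.span (monomial_fun ` {\<alpha>. \<forall>k. \<alpha> k \<le> D})"
    using assms(1) by (simp add: poly_upto_def)
  then show ?thesis
  proof (induction rule: fun_vs.span_induct_alt)
    case base
    then show ?case using zero by (simp add: zero_fun_def)
  next
    case (step c x y)
    have "P (\<lambda>z. c * x z)" using step monomial scale by auto
    from add[OF this step(2)] show ?case by (simp add: plus_fun_def)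
  qed
qed

lemma poly_upto_zero: "(\<lambda>y. 0) \<in> poly_upto D"
  using fun_vs.span_zero unfolding poly_upto_def by (simp add: zero_fun_def)

lemma poly_upto_add:
  assumes "f \<in> poly_upto D" "g \<in> poly_upto D"
  shows "(\<lambda>y. f y + g y) \<in> poly_upto D"
  using fun_vs.span_add[OF assms[unfolded poly_upto_def]]
  unfolding poly_upto_def by (simp add: plus_fun_def)

lemma poly_upto_scale: "f \<in> poly_upto D \<Longrightarrow> (\<lambda>y. c * f y) \<in> poly_upto D"
  unfolding poly_upto_def by (rule fun_vs.span_scale)

lemma poly_upto_monomial: "(\<And>k. \<alpha> k \<le> D) \<Longrightarrow> monomial_fun \<alpha> \<in> poly_upto D"
  unfolding poly_upto_def by (rule fun_vs.span_base) auto

lemma poly_upto_const: "(\<lambda>y. c) \<in> poly_upto D"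
  using poly_upto_scale[OF poly_upto_monomial[of "\<lambda>k. 0" D], of c]
  by (simp add: monomial_fun_def)

lemma poly_upto_coord: "(\<lambda>y. y $ k) \<in> poly_upto 1"
proof -
  have "(\<lambda>y. y $ k) = monomial_fun (\<lambda>l. if l = k then 1 else 0)"
    by (simp add: monomial_fun_def if_distrib[of "\<lambda>n. _ ^ n"] prod.delta cong: if_cong)
  then show ?thesis using poly_upto_monomial[of "\<lambda>l. if l = k then 1 else 0" 1] by simp
qed

lemma poly_upto_mult:
  assumes "f \<in> poly_upto D" "g \<in> poly_upto E"
  shows "(\<lambda>y. f y * g y) \<in> poly_upto (D + E)"
  using assms(1)
proof (induction rule: poly_upto_induct)
  case (monomial \<alpha>)
  show ?case using assms(2)
  proof (induction rule: poly_upto_induct)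
    case (monomial \<beta>)
    have "(\<lambda>y. monomial_fun \<alpha> y * monomial_fun \<beta> y) = monomial_fun (\<lambda>k. \<alpha> k + \<beta> k)"
      by (simp add: monomial_fun_def power_add prod.distrib)
    then show ?case
      using \<open>\<And>k. \<alpha> k \<le> D\<close> monomial by (auto intro!: poly_upto_monomial add_mono)
  next
    case (add f g)
    then show ?case using poly_upto_add[OF add] by (simp add: algebra_simps)
  next
    case (scale c f)
    then show ?case using poly_upto_scale[OF scale, of c] by (simp add: algebra_simps)
  qed (simp add: poly_upto_zero)
next
  case (add f g)
  then show ?case using poly_upto_add[OF add] by (simp add: algebra_simps)
next
  case (scale c f)
  then show ?case using poly_upto_scale[OF scale, of c] by (simp add: algebra_simps)
qed (simp add: poly_upto_zero)

section \<open>Polynomial functions without a degree bound\<close>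

definition is_poly :: "(complex ^ 'n \<Rightarrow> complex) \<Rightarrow> bool" where
  "is_poly f \<longleftrightarrow> (\<exists>D. f \<in> poly_upto D)"

lemma is_poly_const: "is_poly (\<lambda>y. c)"
  and is_poly_coord: "is_poly (\<lambda>y. y $ k)"
  by (auto simp: is_poly_def intro: poly_upto_const poly_upto_coord)

lemma is_poly_add:
  assumes "is_poly f" "is_poly g"
  shows "is_poly (\<lambda>y. f y + g y)"
proof -
  obtain D E where "f \<in> poly_upto D" "g \<in> poly_upto E"
    using assms by (auto simp: is_poly_def)
  then have "f \<in> poly_upto (max D E)" "g \<in> poly_upto (max D E)"
    using poly_upto_mono[of D "max D E"] poly_upto_mono[of E "max D E"] by auto
  from poly_upto_add[OF this] show ?thesis by (auto simp: is_poly_def)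
qed

lemma is_poly_mult: "\<lbrakk>is_poly f; is_poly g\<rbrakk> \<Longrightarrow> is_poly (\<lambda>y. f y * g y)"
  unfolding is_poly_def by (blast intro: poly_upto_mult)

lemma is_poly_uminus: "is_poly f \<Longrightarrow> is_poly (\<lambda>y. - f y)"
  using is_poly_mult[OF is_poly_const[of "-1"], of f] by simp

lemma is_poly_diff: "\<lbrakk>is_poly f; is_poly g\<rbrakk> \<Longrightarrow> is_poly (\<lambda>y. f y - g y)"
  using is_poly_add[of f "\<lambda>y. - g y"] is_poly_uminus[of g] by simp

lemmas is_poly_intros =
  is_poly_const is_poly_coord is_poly_add is_poly_mult is_poly_uminus is_poly_diff

lemma is_poly_line:
  assumes "is_poly f"
  shows "\<exists>p. \<forall>t. f (u + t *s w) = poly p t"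
proof -
  obtain D where "f \<in> poly_upto D" using assms by (auto simp: is_poly_def)
  then show ?thesis
  proof (induction rule: poly_upto_induct)
    case zero
    show ?case by (rule exI[of _ 0]) simp
  next
    case (add f g)
    then obtain p q where "\<forall>t. f (u + t *s w) = poly p t" "\<forall>t. g (u + t *s w) = poly q t"
      by blast
    then show ?case by (intro exI[of _ "p + q"]) simp
  next
    case (scale c f)
    then obtain p where "\<forall>t. f (u + t *s w) = poly p t" by blast
    then show ?case by (intro exI[of _ "smult c p"]) simp
  next
    case (monomial \<alpha>)
    show ?case
      by (rule exI[of _ "\<Prod>k\<in>UNIV. [:u $ k, w $ k:] ^ \<alpha> k"])
        (simp add: monomial_fun_def poly_prod)
  qed
qed

lemma polynomial_fun_prod:
  "(\<And>k. k \<in> K \<Longrightarrow> polynomial_fun (f k)) \<Longrightarrow> polynomial_fun (\<lambda>g. \<Prod>k\<in>K. f k g)"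
  by (induction K rule: infinite_finite_induct) (auto intro: polynomial_fun.intros)

lemma polynomial_fun_power: "polynomial_fun f \<Longrightarrow> polynomial_fun (\<lambda>g. f g ^ n)"
  by (induction n) (auto intro: polynomial_fun.intros)

lemma polynomial_fun_sum:
  "(\<And>k. k \<in> K \<Longrightarrow> polynomial_fun (f k)) \<Longrightarrow> polynomial_fun (\<lambda>g. \<Sum>k\<in>K. f k g)"
  by (induction K rule: infinite_finite_induct) (auto intro: polynomial_fun.intros)

lemma polynomial_fun_diff:
  assumes "polynomial_fun p" "polynomial_fun q"
  shows "polynomial_fun (\<lambda>g. p g - q g)"
  using polynomial_fun.add[OF assms(1) polynomial_fun.mult[OF polynomial_fun.const[of "-1"] assms(2)]]
  by simp

lemma polynomial_fun_compose:
  assumes "is_poly f" and \<pi>: "\<And>k. polynomial_fun (\<lambda>g. \<pi> g $ k)"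
  shows "polynomial_fun (\<lambda>g. f (\<pi> g))"
proof -
  obtain D where "f \<in> poly_upto D" using assms by (auto simp: is_poly_def)
  then show ?thesis
  proof (induction rule: poly_upto_induct)
    case (monomial \<alpha>)
    show ?case
      unfolding monomial_fun_def by (intro polynomial_fun_prod polynomial_fun_power \<pi>)
  qed (auto intro: polynomial_fun.intros)
qed

lemma is_poly_compose:
  assumes "polynomial_fun p" and "\<And>k i j. is_poly (\<lambda>y. \<phi> y $ k $ i $ j)"
  shows "is_poly (\<lambda>y. p (\<phi> y))"
  using assms(1) by induction (auto intro: is_poly_intros assms(2))

section \<open>Linear independence on a subset and monomial counts\<close>

definition indep_on :: "'a set \<Rightarrow> nat \<Rightarrow> (nat \<Rightarrow> 'a \<Rightarrow> complex) \<Rightarrow> bool" where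
  "indep_on S N b \<longleftrightarrow>
    (\<forall>c. (\<forall>x\<in>S. (\<Sum>i<N. c i * b i x) = 0) \<longrightarrow> (\<forall>i<N. c i = 0))"

lemma card_monomials:
  "card {\<alpha> :: 'n::finite \<Rightarrow> nat. \<forall>k. \<alpha> k \<le> D} = (D + 1) ^ CARD('n)"
  "finite {\<alpha> :: 'n::finite \<Rightarrow> nat. \<forall>k. \<alpha> k \<le> D}"
proof -
  have "{\<alpha> :: 'n \<Rightarrow> nat. \<forall>k. \<alpha> k \<le> D} = (\<Pi>\<^sub>E k\<in>UNIV. {..D})"
    by (auto simp: PiE_def Pi_def)
  then show "card {\<alpha> :: 'n \<Rightarrow> nat. \<forall>k. \<alpha> k \<le> D} = (D + 1) ^ CARD('n)"
    "finite {\<alpha> :: 'n \<Rightarrow> nat. \<forall>k. \<alpha> k \<le> D}"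
    by (simp_all add: card_PiE finite_PiE)
qed

lemma fun_sum_apply: "(\<Sum>i\<in>I. f i) x = (\<Sum>i\<in>I. f i x)" for f :: "'a \<Rightarrow> 'b \<Rightarrow> complex"
  by (induction I rule: infinite_finite_induct) auto

text \<open>The exchange bound applied to the span of the (D + 1)^n monomials. That bound concerns
  sets, so the family \<open>b\<close> must first be seen to be injective: a repetition would be a
  nontrivial relation.\<close>

lemma indep_on_card_le:
  fixes b :: "nat \<Rightarrow> complex ^ 'n \<Rightarrow> complex"
  assumes ind: "indep_on UNIV N b" and b: "\<And>i. i < N \<Longrightarrow> b i \<in> poly_upto D"
  shows "N \<le> (D + 1) ^ CARD('n)"
proof -
  have inj: "inj_on b {..<N}"
  proof (rule inj_onI, rule ccontr)
    fix i j assume ij: "i \<in> {..<N}" "j \<in> {..<N}" "b i = b j" "i \<noteq> j"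
    define c :: "nat \<Rightarrow> complex" where "c k = (if k = i then 1 else 0) - (if k = j then 1 else 0)" for k
    have "(\<Sum>k<N. c k * b k x) = 0" for x
      using ij by (simp add: c_def left_diff_distrib sum_subtractf if_distrib[of "\<lambda>a. a * _"] sum.delta cong: if_cong)
    then have "c i = 0" using ind ij by (auto simp: indep_on_def)
    then show False using ij by (simp add: c_def)
  qed
  have "fun_vs.independent (b ` {..<N})"
    unfolding fun_vs.independent_explicit_finite_subsets
  proof (intro allI impI ballI)
    fix A u v assume A: "A \<subseteq> b ` {..<N}" "finite A" and s: "(\<Sum>v\<in>A. (\<lambda>x. u v * v x)) = 0"
      and v: "v \<in> A"
    define c where "c k = (if b k \<in> A then u (b k) else 0)" for k
    have "(\<Sum>k<N. c k * b k x) = 0" for x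
    proof -
      have "(\<Sum>k<N. c k * b k x) = (\<Sum>k\<in>{k\<in>{..<N}. b k \<in> A}. u (b k) * b k x)"
        by (rule sum.mono_neutral_cong_right) (auto simp: c_def)
      also have "\<dots> = (\<Sum>v\<in>A. u v * v x)"
        by (rule sum.reindex_bij_betw[of b])
          (use A inj in \<open>auto simp: bij_betw_def inj_on_def\<close>)
      also have "\<dots> = (\<Sum>v\<in>A. (\<lambda>x. u v * v x)) x" by (simp add: fun_sum_apply)
      finally show ?thesis using s by simp
    qed
    then have "\<forall>i<N. c i = 0" using ind by (auto simp: indep_on_def)
    then show "u v = 0" using v A by (auto simp: c_def split: if_splits)
  qed
  moreover have "b ` {..<N} \<subseteq> fun_vs.span (monomial_fun ` {\<alpha>. \<forall>k. \<alpha> k \<le> D})"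
    using b by (auto simp: poly_upto_def)
  ultimately have "card (b ` {..<N}) \<le> card (monomial_fun ` {\<alpha> :: 'n \<Rightarrow> nat. \<forall>k. \<alpha> k \<le> D})"
    using fun_vs.independent_span_bound[OF finite_imageI[OF card_monomials(2)]] by blast
  also have "\<dots> \<le> (D + 1) ^ CARD('n)"
    using card_image_le[OF card_monomials(2)[where 'n='n, of D], of monomial_fun]
    by (simp add: card_monomials)
  finally show ?thesis using inj by (simp add: card_image)
qed

subsection \<open>Dimension of an embedded affine space\<close>

lemma zariski_closed_Int:
  assumes "zariski_closed A" "zariski_closed B"
  shows "zariski_closed (A \<inter> B)"
proof -
  obtain F where "\<forall>f\<in>F. polynomial_fun f" "A = {g. \<forall>f\<in>F. f g = 0}"
    using assms(1) by (auto simp: zariski_closed_def)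
  moreover obtain G where "\<forall>f\<in>G. polynomial_fun f" "B = {g. \<forall>f\<in>G. f g = 0}"
    using assms(2) by (auto simp: zariski_closed_def)
  ultimately show ?thesis
    unfolding zariski_closed_def by (intro exI[of _ "F \<union> G"]) auto
qed

lemma zariski_closed_zeros: "polynomial_fun f \<Longrightarrow> zariski_closed {g. f g = 0}"
  unfolding zariski_closed_def by (intro exI[of _ "{f}"]) auto

lemma zariski_closed_separate:
  assumes "zariski_closed A" "x \<notin> A"
  obtains f where "polynomial_fun f" "\<forall>a\<in>A. f a = 0" "f x \<noteq> 0"
  using assms unfolding zariski_closed_def by blast

text \<open>The coordinate ring of an irreducible set is a domain: the zero sets of \<open>f\<close>
  and \<open>h\<close> cover \<open>Z\<close>, so one of them is all of \<open>Z\<close>.\<close>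

lemma affine_variety_mult_eq_0:
  assumes Z: "affine_variety Z" and f: "polynomial_fun f" and h: "polynomial_fun h"
    and fh: "\<And>x. x \<in> Z \<Longrightarrow> f x * h x = 0" and x: "x \<in> Z" "f x \<noteq> 0"
  shows "\<forall>z\<in>Z. h z = 0"
proof -
  have "zariski_closed (Z \<inter> {g. f g = 0})" "zariski_closed (Z \<inter> {g. h g = 0})"
    using Z f h by (auto simp: affine_variety_def intro: zariski_closed_Int zariski_closed_zeros)
  moreover have "Z = (Z \<inter> {g. f g = 0}) \<union> (Z \<inter> {g. h g = 0})"
    using fh by auto
  ultimately have "Z = Z \<inter> {g. f g = 0} \<or> Z = Z \<inter> {g. h g = 0}"
    using Z unfolding affine_variety_def by blast
  then show ?thesis using x by auto
qed

lemma indep_onD: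
  "\<lbrakk>indep_on S N b; \<And>x. x \<in> S \<Longrightarrow> (\<Sum>i<N. c i * b i x) = 0; i < N\<rbrakk> \<Longrightarrow> c i = 0"
  by (auto simp: indep_on_def)

lemma sum_lessThan_add:
  "(\<Sum>i<M + N. h i) = (\<Sum>i<M. h i) + (\<Sum>i<N. h (M + i))" for h :: "nat \<Rightarrow> complex"
  by (induction N) (simp_all add: add.assoc)

text \<open>If \<open>f\<close> vanishes on \<open>Z'\<close> but not on the irreducible \<open>Z\<close>, then multiplication by \<open>f\<close> is
  injective on the coordinate ring of \<open>Z\<close>, with image in the kernel of the restriction to \<open>Z'\<close>.\<close>

lemma indep_on_append:
  assumes Z: "affine_variety Z" and "Z' \<subseteq> Z"
    and f: "polynomial_fun f" "\<forall>z\<in>Z'. f z = 0" "x \<in> Z" "f x \<noteq> 0"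
    and b: "indep_on Z N b" "\<forall>i<N. polynomial_fun (b i)"
    and b': "indep_on Z' M b'"
  shows "indep_on Z (M + N) (\<lambda>i. if i < M then b' i else (\<lambda>g. f g * b (i - M) g))"
  unfolding indep_on_def
proof (rule allI, rule impI)
  fix c assume c: "\<forall>x\<in>Z. (\<Sum>i<M + N.
      c i * (if i < M then b' i else (\<lambda>g. f g * b (i - M) g)) x) = 0"
  have split: "(\<Sum>i<M. c i * b' i g) + f g * (\<Sum>i<N. c (M + i) * b i g) = 0" if "g \<in> Z" for g
  proof -
    have "(\<Sum>i<M + N. c i * (if i < M then b' i else (\<lambda>g. f g * b (i - M) g)) g) =
      (\<Sum>i<M. c i * b' i g) + (\<Sum>i<N. c (M + i) * (f g * b i g))"
      by (simp add: sum_lessThan_add)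
    also have "(\<Sum>i<N. c (M + i) * (f g * b i g)) = f g * (\<Sum>i<N. c (M + i) * b i g)"
      unfolding sum_distrib_left by (intro sum.cong refl) (rule mult.left_commute)
    finally show ?thesis using bspec[OF c that] by (rule trans[OF sym])
  qed
  have "(\<Sum>i<M. c i * b' i g) = 0" if "g \<in> Z'" for g
  proof -
    have "g \<in> Z" "f g = 0" using that f(2) \<open>Z' \<subseteq> Z\<close> by auto
    then show ?thesis using split[of g] by simp
  qed
  then have c1: "\<forall>i<M. c i = 0" using indep_onD[OF b'] by blast
  have "polynomial_fun (\<lambda>g. \<Sum>i<N. c (M + i) * b i g)"
  proof (rule polynomial_fun_sum)
    fix i assume "i \<in> {..<N}"
    then have "polynomial_fun (b i)" using b(2) by simp
    from polynomial_fun.mult[OF polynomial_fun.const this]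
    show "polynomial_fun (\<lambda>g. c (M + i) * b i g)" .
  qed
  moreover have "f g * (\<Sum>i<N. c (M + i) * b i g) = 0" if "g \<in> Z" for g
    using split[OF that] c1 by simp
  ultimately have "\<forall>g\<in>Z. (\<Sum>i<N. c (M + i) * b i g) = 0"
    by (rule affine_variety_mult_eq_0[OF Z f(1) _ _ f(3,4)])
  then have c2: "\<forall>i<N. c (M + i) = 0"
    using indep_onD[OF b(1), of "\<lambda>i. c (M + i)"] by blast
  show "\<forall>i<M + N. c i = 0"
  proof (intro allI impI)
    fix i assume "i < M + N"
    then consider "i < M" | "M \<le> i" "i - M < N" by linarith
    then show "c i = 0"
    proof cases
      case 1
      then show ?thesis using c1 by blast
    next
      case 2
      then show ?thesis using c2[THEN spec, of "i - M"] by simp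
    qed
  qed
qed

section \<open>Closed embeddings of affine space with a polynomial left inverse\<close>

locale polynomial_cell =
  fixes \<phi> :: "complex ^ 'n \<Rightarrow> matrices4" and \<pi> :: "matrices4 \<Rightarrow> complex ^ 'n"
  assumes is_poly_\<phi>: "\<And>k i j. is_poly (\<lambda>y. \<phi> y $ k $ i $ j)"
    and polynomial_fun_\<pi>: "\<And>k. polynomial_fun (\<lambda>g. \<pi> g $ k)"
    and \<pi>_\<phi> [simp]: "\<And>y. \<pi> (\<phi> y) = y"
begin

definition coord_image :: "'n set \<Rightarrow> matrices4 set" where
  "coord_image K = \<phi> ` {y. \<forall>k\<in>K. y $ k = 0}"

text \<open>The image of \<open>\<phi>\<close> is the fixed set of
  \<open>\<phi> \<circ> \<pi>\<close>, which is given by polynomial equations; the coordinates in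
  \<open>K\<close> are cut out by pulling them back along \<open>\<pi>\<close>.\<close>

lemma zariski_closed_coord_image: "zariski_closed (coord_image K)"
proof -
  define F where "F = range (\<lambda>(k, i, j) g. \<phi> (\<pi> g) $ k $ i $ j - g $ k $ i $ j) \<union> (\<lambda>k g. \<pi> g $ k) ` K"
  have "polynomial_fun (\<lambda>g. \<phi> (\<pi> g) $ k $ i $ j - g $ k $ i $ j)" for k i j
    by (intro polynomial_fun_diff[OF
        polynomial_fun_compose[OF is_poly_\<phi> polynomial_fun_\<pi>] polynomial_fun.coord])
  then have "\<forall>f\<in>F. polynomial_fun f"
    by (auto simp: F_def polynomial_fun_\<pi>)
  moreover have "coord_image K = {g. \<forall>f\<in>F. f g = 0}"
  proof (rule set_eqI)
    fix g
    have "(\<forall>f\<in>F. f g = 0) \<longleftrightarrow> \<phi> (\<pi> g) = g \<and> (\<forall>k\<in>K. \<pi> g $ k = 0)"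
      by (simp add: F_def ball_Un vec_eq_iff)
    moreover have "g \<in> coord_image K \<longleftrightarrow> \<phi> (\<pi> g) = g \<and> (\<forall>k\<in>K. \<pi> g $ k = 0)"
    proof
      assume R: "\<phi> (\<pi> g) = g \<and> (\<forall>k\<in>K. \<pi> g $ k = 0)"
      then have "\<pi> g \<in> {y. \<forall>k\<in>K. y $ k = 0}" by simp
      then have "\<phi> (\<pi> g) \<in> coord_image K" unfolding coord_image_def by (rule imageI)
      then show "g \<in> coord_image K" using R by simp
    qed (auto simp: coord_image_def)
    ultimately show "g \<in> coord_image K \<longleftrightarrow> g \<in> {g. \<forall>f\<in>F. f g = 0}" by simp
  qed
  ultimately show ?thesis unfolding zariski_closed_def by blast
qed

text \<open>Irreducibility is tested on lines. If \<open>A\<close> misses \<open>x\<close> and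
  \<open>B\<close> misses \<open>y\<close>, the line joining their parameters stays in the
  coordinate subspace, and the separating polynomials restrict to two nonzero univariate polynomials
  with zero product.\<close>

lemma affine_variety_coord_image: "affine_variety (coord_image K)"
proof -
  have "\<phi> 0 \<in> coord_image K" by (auto simp: coord_image_def)
  moreover have "coord_image K = A \<or> coord_image K = B"
    if AB: "zariski_closed A" "zariski_closed B" "coord_image K = A \<union> B" for A B
  proof (rule ccontr)
    assume "\<not> ?thesis"
    then obtain x y where xy: "x \<in> coord_image K" "x \<notin> A" "y \<in> coord_image K" "y \<notin> B"
      using AB(3) by blast
    obtain f h where f: "polynomial_fun f" "\<forall>a\<in>A. f a = 0" "f x \<noteq> 0"
      and h: "polynomial_fun h" "\<forall>a\<in>B. h a = 0" "h y \<noteq> 0"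
      using zariski_closed_separate AB(1,2) xy by metis
    obtain u v where u: "x = \<phi> u" "\<forall>k\<in>K. u $ k = 0" and v: "y = \<phi> v" "\<forall>k\<in>K. v $ k = 0"
      using xy by (auto simp: coord_image_def)
    obtain p q where p: "\<And>t. f (\<phi> (u + t *s (v - u))) = poly p t"
      and q: "\<And>t. h (\<phi> (u + t *s (v - u))) = poly q t"
      using is_poly_line[OF is_poly_compose[OF f(1)]] is_poly_line[OF is_poly_compose[OF h(1)]]
        is_poly_\<phi> by metis
    have "poly (p * q) t = 0" for t
    proof -
      have "\<phi> (u + t *s (v - u)) \<in> A \<union> B"
        unfolding AB(3)[symmetric] coord_image_def using u v by (intro imageI) auto
      then show ?thesis using f(2) h(2) p[of t] q[of t] by auto
    qed
    then have "p * q = 0" using poly_all_0_iff_0 by blast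
    moreover have "poly p 0 \<noteq> 0" using p[of 0] f(3) u by simp
    moreover have "poly q 1 \<noteq> 0" using q[of 1] h(3) v by simp
    ultimately show False by auto
  qed
  ultimately show ?thesis
    using zariski_closed_coord_image unfolding affine_variety_def by blast
qed

lemma range_eq_coord_image: "range \<phi> = coord_image {}"
  by (simp add: coord_image_def)

text \<open>A lower bound \<open>N\<close> for the Hilbert function of \<open>Z\<close> at
  \<open>d\<close>, that is, for the dimension of the space of restrictions to \<open>Z\<close> of
  polynomials of degree at most \<open>d\<close>. Degrees are measured after pullback along
  \<open>\<phi>\<close>, in the parameters.\<close>

definition hilbert_ge :: "matrices4 set \<Rightarrow> nat \<Rightarrow> nat \<Rightarrow> bool" where
  "hilbert_ge Z d N \<longleftrightarrow> (\<exists>b. indep_on Z N b \<and>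
    (\<forall>j<N. polynomial_fun (b j) \<and> (\<lambda>y. b j (\<phi> y)) \<in> poly_upto d))"

lemma hilbert_ge_1:
  assumes "Z \<noteq> {}"
  shows "hilbert_ge Z d 1"
proof -
  have "indep_on Z 1 (\<lambda>_ _. 1)"
    unfolding indep_on_def
  proof (intro allI impI)
    fix c :: "nat \<Rightarrow> complex" and i :: nat
    assume c: "\<forall>x\<in>Z. (\<Sum>i<1. c i * 1) = 0" and "i < 1"
    obtain x where "x \<in> Z" using assms by blast
    from bspec[OF c this] \<open>i < 1\<close> show "c i = 0" by simp
  qed
  moreover have "\<forall>j<1::nat. polynomial_fun (\<lambda>_. 1) \<and> (\<lambda>y. 1) \<in> (poly_upto d :: (complex ^ 'n \<Rightarrow> complex) set)"
    by (simp add: polynomial_fun.const poly_upto_const)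
  ultimately show ?thesis unfolding hilbert_ge_def by (intro exI[of _ "\<lambda>_ _. 1"] conjI)
qed

text \<open>Functions independent on \<open>Z'\<close>, together with \<open>f\<close> times
  functions independent on \<open>Z\<close>, stay independent on \<open>Z\<close>; the factor
  \<open>f\<close> costs \<open>e\<close> in the degree.\<close>

lemma hilbert_ge_add:
  assumes Z: "affine_variety Z" "Z' \<subseteq> Z"
    and f: "polynomial_fun f" "\<forall>z\<in>Z'. f z = 0" "x \<in> Z" "f x \<noteq> 0" "(\<lambda>y. f (\<phi> y)) \<in> poly_upto e"
    and "hilbert_ge Z' (e + d) M" "hilbert_ge Z d N"
  shows "hilbert_ge Z (e + d) (M + N)"
proof -
  from \<open>hilbert_ge Z' (e + d) M\<close> obtain b' where b': "indep_on Z' M b'"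
    "\<forall>j<M. polynomial_fun (b' j)" "\<forall>j<M. (\<lambda>y. b' j (\<phi> y)) \<in> poly_upto (e + d)"
    by (auto simp: hilbert_ge_def)
  from \<open>hilbert_ge Z d N\<close> obtain b where b: "indep_on Z N b"
    "\<forall>j<N. polynomial_fun (b j)" "\<forall>j<N. (\<lambda>y. b j (\<phi> y)) \<in> poly_upto d"
    by (auto simp: hilbert_ge_def)
  define c where "c j = (if j < M then b' j else (\<lambda>g. f g * b (j - M) g))" for j
  have "indep_on Z (M + N) c"
    using indep_on_append[OF Z f(1-4) b(1,2) b'(1)] by (simp add: c_def[abs_def])
  moreover have "polynomial_fun (c j) \<and> (\<lambda>y. c j (\<phi> y)) \<in> poly_upto (e + d)"
    if j: "j < M + N" for j
  proof (cases "j < M")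
    case True
    then show ?thesis using b'(2,3) by (simp add: c_def)
  next
    case False
    then have "j - M < N" using j by linarith
    then have "polynomial_fun (b (j - M))" "(\<lambda>y. b (j - M) (\<phi> y)) \<in> poly_upto d"
      using b(2,3) by blast+
    then show ?thesis
      using False polynomial_fun.mult[OF f(1)] poly_upto_mult[OF f(5)] by (simp add: c_def)
  qed
  ultimately show ?thesis unfolding hilbert_ge_def by blast
qed

text \<open>A relation among the pullbacks on the whole parameter space holds at every point of
  \<open>Z\<close>, so independence on \<open>Z\<close> passes to the pullbacks, where monomials can
  be counted.\<close>

lemma hilbert_ge_card_le:
  assumes "hilbert_ge Z d N" "Z \<subseteq> range \<phi>"
  shows "N \<le> (d + 1) ^ CARD('n)"
proof -
  from assms(1) obtain b where b: "indep_on Z N b" "\<forall>j<N. (\<lambda>y. b j (\<phi> y)) \<in> poly_upto d"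
    by (auto simp: hilbert_ge_def)
  have "indep_on UNIV N (\<lambda>j y. b j (\<phi> y))"
    unfolding indep_on_def
  proof (rule allI, rule impI)
    fix c assume c: "\<forall>y\<in>UNIV. (\<Sum>j<N. c j * b j (\<phi> y)) = 0"
    have "(\<Sum>j<N. c j * b j x) = 0" if "x \<in> Z" for x
      using that assms(2) c by auto
    then show "\<forall>j<N. c j = 0" using indep_onD[OF b(1)] by blast
  qed
  from indep_on_card_le[OF this] b(2) show ?thesis by simp
qed

lemma separating_polynomial:
  assumes "zariski_closed Z'" "Z' \<subset> Z"
  shows "\<exists>D f x. polynomial_fun f \<and> (\<forall>z\<in>Z'. f z = 0) \<and> x \<in> Z \<and> f x \<noteq> 0 \<and>
    (\<lambda>y. f (\<phi> y)) \<in> poly_upto D"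
proof -
  obtain x where x: "x \<in> Z" "x \<notin> Z'" using assms(2) by blast
  obtain f where f: "polynomial_fun f" "\<forall>z\<in>Z'. f z = 0" "f x \<noteq> 0"
    using assms(1) x(2) by (rule zariski_closed_separate)
  obtain D where "(\<lambda>y. f (\<phi> y)) \<in> poly_upto D"
    using is_poly_compose[OF f(1) is_poly_\<phi>] by (auto simp: is_poly_def)
  then show ?thesis using f x(1) by blast
qed

text \<open>By \<open>hilbert_ge_add\<close> the lower bounds satisfy Pascal's recursion.\<close>

lemma chain_hilbert_ge:
  assumes Z: "\<And>i. i \<le> n \<Longrightarrow> affine_variety (Z i)" and chain: "\<And>i. i < n \<Longrightarrow> Z i \<subset> Z (Suc i)"
  shows "\<exists>e. \<forall>i\<le>n. \<forall>d. hilbert_ge (Z i) (e * d) ((d + i) choose i)"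
proof -
  let ?Q = "\<lambda>i D. \<exists>f x. polynomial_fun f \<and> (\<forall>z\<in>Z i. f z = 0) \<and> x \<in> Z (Suc i) \<and> f x \<noteq> 0 \<and>
    (\<lambda>y. f (\<phi> y)) \<in> poly_upto D"
  have "\<exists>D. ?Q i D" if "i < n" for i
    using separating_polynomial[of "Z i" "Z (Suc i)"] Z[of i] chain[of i] that
    by (simp add: affine_variety_def)
  then have "\<forall>i. \<exists>D. i < n \<longrightarrow> ?Q i D" by simp
  from choice[OF this] obtain D where D: "\<forall>i. i < n \<longrightarrow> ?Q i (D i)" ..
  \<comment> \<open>The sum serves as a common degree bound for the separating polynomials of all
    steps of the chain.\<close>
  define e where "e = (\<Sum>i<n. D i)"
  have e: "?Q i e" if "i < n" for i
  proof -
    have "D i \<le> e" unfolding e_def using that by (intro member_le_sum) auto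
    then have "poly_upto (D i) \<subseteq> (poly_upto e :: (complex ^ 'n \<Rightarrow> complex) set)"
      by (rule poly_upto_mono)
    moreover have "?Q i (D i)" using D that by simp
    ultimately show ?thesis by blast
  qed
  have ne: "Z i \<noteq> {}" if "i \<le> n" for i using Z[OF that] by (simp add: affine_variety_def)
  have "hilbert_ge (Z i) (e * d) ((d + i) choose i)" if "i \<le> n" for i d
    using that
  proof (induction i arbitrary: d)
    case 0
    then show ?case using hilbert_ge_1[OF ne[OF 0]] by simp
  next
    case (Suc i)
    note IH = Suc.IH and le = Suc.prems
    show ?case
    \<comment> \<open>The inner induction matches the second argument of Pascal's rule; for
      \<open>d = 0\<close> the binomial coefficient is 1 and nonemptiness suffices.\<close>
    proof (induction d)
      case 0
      then show ?case using hilbert_ge_1[OF ne[OF le]] by simp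
    next
      case (Suc d)
      have "i < n" using le by simp
      then obtain f x where f: "polynomial_fun f" "\<forall>z\<in>Z i. f z = 0" "x \<in> Z (Suc i)" "f x \<noteq> 0"
        "(\<lambda>y. f (\<phi> y)) \<in> poly_upto e"
        using e[of i] by auto
      have "Z i \<subseteq> Z (Suc i)" using chain[OF \<open>i < n\<close>] by auto
      moreover have "hilbert_ge (Z i) (e + e * d) ((Suc d + i) choose i)"
        using IH[of "Suc d"] le by simp
      ultimately have "hilbert_ge (Z (Suc i)) (e + e * d)
          (((Suc d + i) choose i) + ((d + Suc i) choose Suc i))"
        using Suc.IH by (intro hilbert_ge_add[OF Z[OF le] _ f])
      then show ?case by simp
    qed
  qed
  then show ?thesis by blast
qed

text \<open>Growth in \<open>d\<close>: the lower bound is at least (d/n)^n, while the upper bound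
  is of order d^N with N = \<open>CARD('n)\<close>, which is impossible for n > N and large
  \<open>d\<close>.\<close>

lemma chain_length_le:
  assumes Z: "\<And>i. i \<le> n \<Longrightarrow> affine_variety (Z i)" and chain: "\<And>i. i < n \<Longrightarrow> Z i \<subset> Z (Suc i)"
    and V: "Z n \<subseteq> range \<phi>"
  shows "n \<le> CARD('n)"
proof (rule ccontr)
  assume n: "\<not> ?thesis"
  let ?N = "CARD('n)"
  from chain_hilbert_ge[of n Z, OF Z chain]
  obtain e where "\<forall>i\<le>n. \<forall>d. hilbert_ge (Z i) (e * d) ((d + i) choose i)" by auto
  then have le: "((d + n) choose n) \<le> (e * d + 1) ^ ?N" for d
    using hilbert_ge_card_le[OF _ V] by simp
  \<comment> \<open>\<open>C\<close> collects the constants of the comparison, where e d + 1 is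
    replaced by (e + 1) d, as d is positive. What remains is d^(n - N) \<le> C, so
    \<open>C + 1\<close> is large enough.\<close>
  define C where "C = n ^ n * (e + 1) ^ ?N"
  define d where "d = C + 1"
  have "0 < n" using n by linarith
  have "(real d / real n) ^ n \<le> (real (d + n) / real n) ^ n"
    by (intro power_mono divide_right_mono) auto
  also have "\<dots> \<le> real ((d + n) choose n)"
    using binomial_ge_n_over_k_pow_k[of n "d + n", where 'a = real] by simp
  also have "\<dots> \<le> real ((e * d + 1) ^ ?N)" using le[of d] by linarith
  also have "\<dots> \<le> real (((e + 1) * d) ^ ?N)"
    by (intro of_nat_mono power_mono) (auto simp: d_def)
  finally have "real d ^ n \<le> real n ^ n * real (((e + 1) * d) ^ ?N)"
    using \<open>0 < n\<close> by (simp add: power_divide field_simps)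
  then have "d ^ n \<le> n ^ n * ((e + 1) * d) ^ ?N"
    by (metis of_nat_le_iff of_nat_mult of_nat_power)
  also have "n ^ n * ((e + 1) * d) ^ ?N = C * d ^ ?N"
    unfolding C_def power_mult_distrib mult.assoc ..
  also have "d ^ n = d ^ (n - ?N) * d ^ ?N"
    using n by (simp add: power_add[symmetric])
  finally have "d ^ (n - ?N) \<le> C" by (simp add: d_def)
  moreover have "d ^ 1 \<le> d ^ (n - ?N)"
    using n by (intro power_increasing) (auto simp: d_def)
  ultimately show False by (simp add: d_def)
qed

theorem variety_dim_range: "variety_dim (range \<phi>) = enat CARD('n)"
proof (rule antisym)
  show "variety_dim (range \<phi>) \<le> enat CARD('n)"
    unfolding variety_dim_def
  proof (rule Sup_least, clarify)
    fix n Z assume "\<forall>i\<le>n. affine_variety (Z i) \<and> Z i \<subseteq> range \<phi>" "\<forall>i<n. Z i \<subset> Z (Suc i)"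
    then show "enat n \<le> enat CARD('n)" using chain_length_le[of n Z] by simp
  qed
next
  obtain idx :: "'n \<Rightarrow> nat" where idx: "bij_betw idx UNIV {0..<CARD('n)}"
    using ex_bij_betw_finite_nat[of "UNIV :: 'n set"] by auto
  \<comment> \<open>\<open>Z i\<close> frees the first \<open>i\<close> coordinates, starting from
    the single point \<open>\<phi> 0\<close>; the unit vector of the newly freed coordinate
    witnesses strictness.\<close>
  define Z where "Z i = coord_image {k. i \<le> idx k}" for i
  have "Z i \<subset> Z (Suc i)" if "i < CARD('n)" for i
  proof -
    have "i \<in> range idx" using that idx by (simp add: bij_betw_def)
    then obtain k where k: "idx k = i" by auto
    have "inj idx" using idx by (simp add: bij_betw_def)
    then have "\<phi> (axis k 1) \<in> Z (Suc i)"
      using k by (auto simp: Z_def coord_image_def axis_def)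
    moreover have "\<phi> (axis k 1) \<notin> Z i"
    proof
      assume "\<phi> (axis k 1) \<in> Z i"
      then obtain y where "\<phi> (axis k 1) = \<phi> y" "y $ k = 0"
        using k by (auto simp: Z_def coord_image_def)
      then show False using \<pi>_\<phi>[of y] \<pi>_\<phi>[of "axis k 1"] by (auto simp: axis_def)
    qed
    moreover have "Z i \<subseteq> Z (Suc i)" by (auto simp: Z_def coord_image_def)
    ultimately show ?thesis by blast
  qed
  moreover have "Z i \<subseteq> range \<phi>" for i by (auto simp: Z_def coord_image_def)
  moreover have "affine_variety (Z i)" for i by (simp add: Z_def affine_variety_coord_image)
  ultimately show "enat CARD('n) \<le> variety_dim (range \<phi>)"
    unfolding variety_dim_def by (intro Sup_upper) blast
qed

end

subsection \<open>Pfaffian decomposition of the transformed SWAP gate\<close>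

lemma UNIV_4_from_0: "UNIV = {0, 1, 2, 3::4}"
proof -
  have "(4::4) = 0" by simp
  then show ?thesis unfolding UNIV_4 by auto
qed

lemma less_4:
  "(0::4) < 1" "(0::4) < 2" "(0::4) < 3" "(1::4) < 2" "(1::4) < 3" "(2::4) < 3"
  by (simp_all add: less_bit0_def bit0.Rep_numeral bit0.Rep_0 bit0.Rep_1)

lemma UNIV_2_from_0: "UNIV = {0, 1::2}"
proof -
  have "(2::2) = 0" by simp
  then show ?thesis unfolding UNIV_2 by auto
qed

lemma sum_Pow_insert:
  fixes f :: "'a set \<Rightarrow> 'b::comm_monoid_add"
  assumes "finite A" "a \<notin> A"
  shows "sum f (Pow (insert a A)) = sum f (Pow A) + (\<Sum>I\<in>Pow A. f (insert a I))"
proof -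
  have "inj_on (insert a) (Pow A)" using assms(2) by (auto simp: inj_on_def)
  moreover have "Pow A \<inter> insert a ` Pow A = {}" using assms(2) by auto
  ultimately show ?thesis
    using assms(1) by (simp add: Pow_insert sum.union_disjoint sum.reindex)
qed

text \<open>Even subsets come first and odd ones are bracketed together, matching the splitting into
  a Pfaffian and an odd part.\<close>

lemma sum_4_subsets:
  fixes f :: "4 set \<Rightarrow> complex"
  shows "(\<Sum>I\<in>UNIV. f I) =
    f {} + f {0, 1} + f {0, 2} + f {0, 3} + f {1, 2} + f {1, 3} + f {2, 3} + f {0, 1, 2, 3} +
    (f {0} + f {1} + f {2} + f {3} + f {0, 1, 2} + f {0, 1, 3} + f {0, 2, 3} + f {1, 2, 3})"
  unfolding Pow_UNIV[symmetric] UNIV_4_from_0 by (simp add: sum_Pow_insert insert_commute)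

section \<open>Pfaffians of sizes two and four\<close>

lemma pfaffian_2:
  assumes "B 1 0 = - B 0 1"
  shows "pfaffian 2 B = B 0 1"
proof -
  have *: "{..<2::nat} = {0, 1}" by auto
  have f01: "finite {1::nat}" "0 \<notin> {1::nat}"
    by auto
  show ?thesis
    unfolding pfaffian_def * sum_over_permutations_insert[OF f01] permutes_sing
    using assms
    by (simp add: sign_swap_id sign_id lessThan_Suc)
qed

text \<open>Each of the three perfect matchings arises from 8 of the 24 permutations with the same
  signed product, which cancels the denominator 2^2 * 2!.\<close>

lemma pfaffian_4:
  assumes B: "\<And>i j. i < 4 \<Longrightarrow> j < 4 \<Longrightarrow> B j i = - B i j"
  shows "pfaffian 4 B = B 0 1 * B 2 3 - B 0 2 * B 1 3 + B 0 3 * B 1 2"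
proof -
  have *: "{..<4::nat} = {0, 1, 2, 3}" by auto
  have f: "finite {1::nat, 2, 3}" "0 \<notin> {1::nat, 2, 3}"
    "finite {2::nat, 3}" "1 \<notin> {2::nat, 3}" "finite {3::nat}" "2 \<notin> {3::nat}"
    by auto
  have 2: "{..<4 div 2::nat} = {0, 1}" by auto
  show ?thesis
    unfolding pfaffian_def * sum_over_permutations_insert[OF f(1,2)] sum_over_permutations_insert[OF f(3,4)]
      sum_over_permutations_insert[OF f(5,6)] permutes_sing 2
    using B[of 0 1] B[of 0 2] B[of 0 3] B[of 1 2] B[of 1 3] B[of 2 3]
    by (simp add: sign_swap_id permutation_swap_id permutation_compose sign_compose sign_id swap_id_eq fact_numeral)
qed

section \<open>Coefficients of the transformed gate and the matching skew matrix\<close>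

definition swap_coeff :: "complex ^ 2 ^ 2 \<Rightarrow> complex ^ 2 ^ 2 \<Rightarrow> 4 set \<Rightarrow> complex" where
  "swap_coeff M N I =
    M $ indicator I 0 $ indicator I 2 * N $ indicator I 1 $ indicator I 3"

text \<open>SWAP is the product of the standard bilinear pairings of factor 0 with factor 2 and of
  factor 1 with factor 3. The basis change turns their matrices into g0^T g2 and g1^T g3.\<close>

lemma change_basis_SWAP:
  "change_basis SWAP g =
    (\<lambda>x. \<Sum>I\<in>UNIV. swap_coeff (transpose (g $ 0) ** g $ 2) (transpose (g $ 1) ** g $ 3) I * bra_set I x)"
  by (rule ext)
    (simp add: sum_4_subsets swap_coeff_def change_basis_def SWAP_def bra_set_def bra_def
      matrix_matrix_mult_def matrix_vector_mult_def transpose_def UNIV_2_from_0 algebra_simps)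

text \<open>The only possible candidate: a 2-by-2 Pfaffian is its upper entry, and
  \<open>sPf_dual\<close> attaches it to the complementary index set.\<close>

definition swap_skew :: "complex ^ 2 ^ 2 \<Rightarrow> complex ^ 2 ^ 2 \<Rightarrow> complex ^ 4 ^ 4" where
  "swap_skew M N = (\<chi> i j. if i < j then swap_coeff M N (- {i, j})
    else if j < i then - swap_coeff M N (- {j, i}) else 0)"

lemma transpose_swap_skew: "transpose (swap_skew M N) = - swap_skew M N"
  by (auto simp: swap_skew_def transpose_def vec_eq_iff)

lemma card_less_2: "i < j \<Longrightarrow> card {i, j :: 4} = 2"
  by (auto simp: card_insert_if)

lemma pfaffian_swap_skew_2:
  assumes "i < j"
  shows "pfaffian (card {i, j}) (principal_submatrix (swap_skew M N) {i, j}) = swap_coeff M N (- {i, j})"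
proof -
  have l: "sorted_list_of_set {i, j} = [i, j]" using assms by (simp add: less_imp_le)
  show ?thesis
    unfolding card_less_2[OF assms]
    using assms by (subst pfaffian_2) (auto simp: principal_submatrix_def l swap_skew_def)
qed

text \<open>The two outer matchings give the same monomial X = M01 M10 N01 N10, the middle one gives
  M11 N11 M00 N00. Under the hypotheses 2 X - M00 N00 collapses to M00 N00, the coefficient at the
  empty set.\<close>

lemma pfaffian_swap_skew_4:
  assumes "M $ 0 $ 1 * M $ 1 $ 0 * (N $ 0 $ 1 * N $ 1 $ 0) = M $ 0 $ 0 * N $ 0 $ 0"
    "M $ 1 $ 1 * N $ 1 $ 1 = 1"
  shows "pfaffian (card {0, 1, 2, 3 :: 4}) (principal_submatrix (swap_skew M N) {0, 1, 2, 3}) = swap_coeff M N {}"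
proof -
  have l: "sorted_list_of_set {0, 1, 2, 3 :: 4} = [0, 1, 2, 3]"
    using less_4 by (simp add: less_imp_le)
  have c: "card {0, 1, 2, 3 :: 4} = 4" by simp
  have "pfaffian 4 (principal_submatrix (swap_skew M N) {0, 1, 2, 3}) =
    M $ 0 $ 1 * N $ 0 $ 1 * (M $ 1 $ 0 * N $ 1 $ 0) - M $ 0 $ 0 * N $ 1 $ 1 * (M $ 1 $ 1 * N $ 0 $ 0)
      + M $ 0 $ 1 * N $ 1 $ 0 * (M $ 1 $ 0 * N $ 0 $ 1)"
    by (subst pfaffian_4)
      (auto simp: principal_submatrix_def l swap_skew_def swap_coeff_def less_4 indicator_def)
  also have "\<dots> = 2 * (M $ 0 $ 1 * M $ 1 $ 0 * (N $ 0 $ 1 * N $ 1 $ 0))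
      - (M $ 1 $ 1 * N $ 1 $ 1) * (M $ 0 $ 0 * N $ 0 $ 0)"
    by (simp add: algebra_simps)
  also have "\<dots> = swap_coeff M N {}"
    unfolding assms by (simp add: swap_coeff_def)
  finally show ?thesis unfolding c .
qed

lemma swap_decomposition:
  assumes "M $ 1 $ 1 * N $ 1 $ 1 = 1"
    and "M $ 0 $ 1 * M $ 1 $ 0 * (N $ 0 $ 1 * N $ 1 $ 0) = M $ 0 $ 0 * N $ 0 $ 0"
  shows "\<exists>P Q. P \<in> pfaffian_cogates \<and> odd_support Q \<and>
    (\<lambda>x. \<Sum>I\<in>UNIV. swap_coeff M N I * bra_set I x) = (\<lambda>x. P x + Q x)"
proof (intro exI conjI)
  let ?A = "swap_skew M N"
  let ?Q = "\<lambda>x. \<Sum>I\<in>UNIV. (if even (card I) then 0 else swap_coeff M N I) * bra_set I x"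
  show "sPf_dual ?A \<in> pfaffian_cogates"
    by (simp add: pfaffian_cogates_def transpose_swap_skew)
  show "odd_support ?Q"
    unfolding odd_support_def by (intro exI[of _ "\<lambda>I. if even (card I) then 0 else swap_coeff M N I"]) simp
  \<comment> \<open>The empty Pfaffian is 1, which is why the coefficient at \<open>UNIV\<close>,
    namely M11 N11, has to be 1.\<close>
  have empty: "pfaffian (card {}) (principal_submatrix ?A {}) = swap_coeff M N UNIV"
    using assms(1) by (simp add: pfaffian_def swap_coeff_def)
  show "(\<lambda>x. \<Sum>I\<in>UNIV. swap_coeff M N I * bra_set I x) = (\<lambda>x. sPf_dual ?A x + ?Q x)"
  proof
    fix x
    have compl: "- {0::4, 1} = {2, 3}" "- {0::4, 2} = {1, 3}" "- {0::4, 3} = {1, 2}"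
      "- {1::4, 2} = {0, 3}" "- {1::4, 3} = {0, 2}" "- {2::4, 3} = {0, 1}" "- {0::4, 1, 2, 3} = {}"
      unfolding Compl_eq_Diff_UNIV UNIV_4_from_0 by auto
    have "sPf_dual ?A x = swap_coeff M N UNIV * bra_set UNIV x + swap_coeff M N {2, 3} * bra_set {2, 3} x
      + swap_coeff M N {1, 3} * bra_set {1, 3} x + swap_coeff M N {1, 2} * bra_set {1, 2} x
      + swap_coeff M N {0, 3} * bra_set {0, 3} x + swap_coeff M N {0, 2} * bra_set {0, 2} x
      + swap_coeff M N {0, 1} * bra_set {0, 1} x + swap_coeff M N {} * bra_set {} x"
      unfolding sPf_dual_def sum_4_subsets
        pfaffian_swap_skew_4[OF assms(2,1)] empty less_4[THEN pfaffian_swap_skew_2] compl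
      by (simp add: pfaffian_def)
    then show "(\<Sum>I\<in>UNIV. swap_coeff M N I * bra_set I x) = sPf_dual ?A x + ?Q x"
      by (simp add: sum_4_subsets UNIV_4_from_0[symmetric])
  qed
qed

section \<open>An explicit four-parameter family\<close>

definition mat2 :: "complex \<Rightarrow> complex \<Rightarrow> complex \<Rightarrow> complex \<Rightarrow> complex ^ 2 ^ 2" where
  "mat2 a b c d = (\<chi> i j. if i = 0 then if j = 0 then a else b else if j = 0 then c else d)"

text \<open>Here \<open>M = (-rs, 1; -1-rs, 1)\<close> and \<open>N = (1+rs, r; s, 1)\<close> solve the two equations, \<open>g\<^sub>0\<close> and \<open>g\<^sub>1\<close>
  are arbitrary upper unipotent matrices, and \<open>g\<^sub>2 = g\<^sub>0\<^sup>-\<^sup>T M\<close>, \<open>g\<^sub>3 = g\<^sub>1\<^sup>-\<^sup>T N\<close>.\<close>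

definition basis_change :: "complex ^ 4 \<Rightarrow> matrices4" where
  "basis_change y = (let r = y $ 0; s = y $ 1; a = y $ 2; b = y $ 3 in
    \<chi> k. if k = 0 then mat2 1 a 0 1
      else if k = 1 then mat2 1 b 0 1
      else if k = 2 then mat2 1 0 (- a) 1 ** mat2 (- r * s) 1 (- 1 - r * s) 1
      else mat2 1 0 (- b) 1 ** mat2 (1 + r * s) r s 1)"

text \<open>The last matrix has first row (1 + rs, r) and lower left entry s - b (1 + rs). Adding b
  times its upper left entry recovers s; a and b are read off the unipotent factors.\<close>

definition basis_change_coords :: "matrices4 \<Rightarrow> complex ^ 4" where
  "basis_change_coords g = (\<chi> k. if k = 0 then g $ 3 $ 0 $ 1
    else if k = 1 then g $ 3 $ 1 $ 0 + g $ 1 $ 0 $ 1 * g $ 3 $ 0 $ 0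
    else if k = 2 then g $ 0 $ 0 $ 1 else g $ 1 $ 0 $ 1)"

lemma mat2_mult:
  "mat2 a b c d ** mat2 a' b' c' d' =
    mat2 (a * a' + b * c') (a * b' + b * d') (c * a' + d * c') (c * b' + d * d')"
  by (simp add: mat2_def matrix_matrix_mult_def vec_eq_iff UNIV_2_from_0)

lemma transpose_mat2: "transpose (mat2 a b c d) = mat2 a c b d"
  by (simp add: mat2_def transpose_def vec_eq_iff)

lemma mat2_nth [simp]:
  "mat2 a b c d $ 0 $ 0 = a" "mat2 a b c d $ 0 $ 1 = b"
  "mat2 a b c d $ 1 $ 0 = c" "mat2 a b c d $ 1 $ 1 = d"
  by (simp_all add: mat2_def)

lemma det_mat2: "det (mat2 a b c d) = a * d - b * c"
  by (simp add: det_2 mat2_def mult.commute)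

lemma is_poly_mat2:
  assumes "is_poly a" "is_poly b" "is_poly c" "is_poly d"
  shows "is_poly (\<lambda>y. mat2 (a y) (b y) (c y) (d y) $ i $ j)"
  using assms by (cases "i = 0"; cases "j = 0") (simp_all add: mat2_def)

interpretation basis_change: polynomial_cell basis_change basis_change_coords
proof
  fix k i j
  show "is_poly (\<lambda>y. basis_change y $ k $ i $ j)"
    by (cases "k = 0"; cases "k = 1"; cases "k = 2")
      (simp_all add: basis_change_def Let_def mat2_mult, (intro is_poly_mat2 is_poly_intros)+)
next
  fix k
  show "polynomial_fun (\<lambda>g. basis_change_coords g $ k)"
    by (cases "k = 0"; cases "k = 1"; cases "k = 2")
      (simp_all add: basis_change_coords_def,
        (intro polynomial_fun.add polynomial_fun.mult polynomial_fun.coord)+)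
next
  fix y
  show "basis_change_coords (basis_change y) = y"
    using UNIV_4_from_0
    by (auto simp: vec_eq_iff basis_change_coords_def basis_change_def Let_def mat2_mult)
qed

theorem theorem4p4:
  "\<exists>V. V \<subseteq> SL2_pow4 \<and> affine_variety V \<and> variety_dim V = 4 \<and>
     (\<forall>g\<in>V. \<exists>P Q. P \<in> pfaffian_cogates \<and> odd_support Q \<and>
        change_basis SWAP g = (\<lambda>x. P x + Q x))"
proof (rule exI, intro conjI ballI)
  \<comment> \<open>The unipotent factors have determinant 1, and so do M (-rs + 1 + rs) and N (1 +
    rs - rs).\<close>
  show "range basis_change \<subseteq> SL2_pow4"
    by (auto simp: SL2_pow4_def basis_change_def Let_def mat2_mult det_mat2 algebra_simps)
  show "affine_variety (range basis_change)"
    unfolding basis_change.range_eq_coord_image by (rule basis_change.affine_variety_coord_image)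
  show "variety_dim (range basis_change) = 4"
    using basis_change.variety_dim_range by (simp add: numeral_eq_enat)
  fix g assume "g \<in> range basis_change"
  then obtain y where g: "g = basis_change y" by auto
  let ?r = "y $ 0" and ?s = "y $ 1"
  have "transpose (g $ 0) ** g $ 2 = mat2 (- ?r * ?s) 1 (- 1 - ?r * ?s) 1"
    "transpose (g $ 1) ** g $ 3 = mat2 (1 + ?r * ?s) ?r ?s 1"
    by (simp_all add: g basis_change_def Let_def mat2_mult transpose_mat2 algebra_simps)
  \<comment> \<open>The lower right entries of M and N are both 1, and M01 M10 N01 N10 and M00 N00
    both equal -rs (1 + rs).\<close>
  then show "\<exists>P Q. P \<in> pfaffian_cogates \<and> odd_support Q \<and> change_basis SWAP g = (\<lambda>x. P x + Q x)"
    unfolding change_basis_SWAP by (simp only:) (rule swap_decomposition, simp_all add: algebra_simps)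
qed

end
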